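(* Let $\alpha\in(0,1)$, $\tau,h>0$, and let $f=f^++f^-$ with $f^\pm:\mathbb{R}\to\mathbb{R}$ continuously differentiable, $(f^+)'\ge 0$ and $(f^-)'\le 0$. Let $\phi^0$ be either the minmod limiter or the Van Leer limiter, and let $(U_j^n)_{j\in\mathbb{Z},n\ge 0}$ be a real solution of the second order (MUSCL) explicit flux splitting scheme, i.e. for all $j\in\mathbb{Z}$, $n\ge0$, $$D_t^\alpha U_j^{n+1}+\frac1h\Big[\big(f_j^{+,n}+\tfrac h2 s_j^{+,n}\big)-\big(f_{j-1}^{+,n}+\tfrac h2 s_{j-1}^{+,n}\big)\Big]+\frac1h\Big[\big(f_{j+1}^{-,n}-\tfrac h2 s_{j+1}^{-,n}\big)-\big(f_j^{-,n}-\tfrac h2 s_j^{-,n}\big)\Big]=0.$$ Let $I\subseteq\mathbb{R}$ be an interval containing all the initial values $U_j^0$ ($j\in\mathbb{Z}$), and suppose that the CFL condition $$\frac{2\,\tau^\alpha}{h\,\Gamma(2-\alpha)}\Big(\sup_{I}|(f^+)'|+\sup_{I}|(f^-)'|\Big)\le \tilde c,\qquad \tilde c:=2-2^{1-\alpha},$$ holds. Then the scheme is TVD and satisfies the maximum principle: for all $n\ge 1$, $$\sum_{j\in\mathbb{Z}}|U_{j+1}^n-U_j^n|\le\sum_{j\in\mathbb{Z}}|U_{j+1}^0-U_j^0|\qquad\text{and}\qquad \sup_{j}|U_j^n|\le\sup_j|U_j^0|.$$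
   Context: The scheme approximates the conservation law $\partial_t^\alpha u+(f(u))_x=0$ with Caputo derivative $\partial_t^\alpha$, on a uniform grid with time step $\tau$ and mesh size $h$. The discrete Caputo derivative is $$D_t^\alpha U_j^{n+1}=\frac{1}{\Gamma(2-\alpha)\tau^\alpha}\Big(U_j^{n+1}-\sum_{k=0}^n c_k^{n+1}U_j^k\Big),\qquad n\ge 0,$$ with $c_0^{n+1}=(n+1)^{1-\alpha}-n^{1-\alpha}$ and $c_k^{n+1}=2(n+1-k)^{1-\alpha}-(n+2-k)^{1-\alpha}-(n-k)^{1-\alpha}$ for $1\le k\le n$ (with $0^{1-\alpha}=0$). Here $f_j^{\pm,n}=f^\pm(U_j^n)$, and the slopes are $$s_j^{\pm,n}=\frac{f_j^{\pm,n}-f_{j-1}^{\pm,n}}{h}\,\phi^0\!\left(\frac{f_{j+1}^{\pm,n}-f_j^{\pm,n}}{f_j^{\pm,n}-f_{j-1}^{\pm,n}}\right),$$ with $s_j^{\pm,n}=0$ when $f_j^{\pm,n}=f_{j-1}^{\pm,n}$. The minmod limiter is $\phi^0(\theta)=\max(0,\min(1,\theta))$; the Van Leer limiter is $\phi^0(\theta)=\frac{|\theta|+\theta}{1+\theta}$, understood as $0$ for all $\theta\le 0$ (including $\theta=-1$). The scheme arises from the piecewise linear reconstruction $f_j^{\pm,n}+s_j^{\pm,n}(x-x_j)$ on $(x_{j-1/2},x_{j+1/2})$, taking left limits at interfaces for $f^+$ and right limits for $f^-$. Sums of nonnegative terms are taken in $[0,\infty]$. *)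

theory Defs
  imports "HOL-Analysis.Analysis"
begin

text \<open>
  Grid functions are maps \<open>U :: nat \<Rightarrow> int \<Rightarrow> real\<close>, where \<open>U n j\<close> is the value at
  time level \<open>n\<close> and spatial index \<open>j\<close>.
\<close>

text \<open>
  \<open>caputo_coeff \<alpha> n k\<close> is the coefficient $c_k^{n+1}$ (for \<open>k \<le> n\<close>). The convention
  $0^{1-\alpha} = 0$ agrees with \<open>0 powr a = 0\<close>.
\<close>

definition caputo_coeff :: "real \<Rightarrow> nat \<Rightarrow> nat \<Rightarrow> real" where
  "caputo_coeff \<alpha> n k =
     (if k = 0 then (real n + 1) powr (1 - \<alpha>) - real n powr (1 - \<alpha>)
      else 2 * (real n + 1 - real k) powr (1 - \<alpha>)
             - (real n + 2 - real k) powr (1 - \<alpha>)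
             - (real n - real k) powr (1 - \<alpha>))"

text \<open>\<open>discrete_caputo \<alpha> \<tau> u n\<close> is $D_t^\alpha u^{n+1}$ (note the index shift).\<close>

definition discrete_caputo :: "real \<Rightarrow> real \<Rightarrow> (nat \<Rightarrow> real) \<Rightarrow> nat \<Rightarrow> real" where
  "discrete_caputo \<alpha> \<tau> u n =
     1 / (Gamma (2 - \<alpha>) * \<tau> powr \<alpha>) *
       (u (Suc n) - (\<Sum>k=0..n. caputo_coeff \<alpha> n k * u k))"

definition minmod :: "real \<Rightarrow> real" where
  "minmod \<theta> = max 0 (min 1 \<theta>)"

definition van_leer :: "real \<Rightarrow> real" where
  "van_leer \<theta> = (if \<theta> \<le> 0 then 0 else (\<bar>\<theta>\<bar> + \<theta>) / (1 + \<theta>))"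

text \<open>In the slope and the reconstruction, \<open>F j\<close> stands for $f_j^{\pm,n}$ at a fixed time level.\<close>

definition muscl_slope :: "(real \<Rightarrow> real) \<Rightarrow> real \<Rightarrow> (int \<Rightarrow> real) \<Rightarrow> int \<Rightarrow> real" where
  "muscl_slope \<phi> h F j =
     (if F j = F (j - 1) then 0
      else (F j - F (j - 1)) / h * \<phi> ((F (j + 1) - F j) / (F j - F (j - 1))))"

definition muscl_scheme ::
  "real \<Rightarrow> real \<Rightarrow> real \<Rightarrow> (real \<Rightarrow> real) \<Rightarrow> (real \<Rightarrow> real) \<Rightarrow> (real \<Rightarrow> real) \<Rightarrow>
   (nat \<Rightarrow> int \<Rightarrow> real) \<Rightarrow> bool" where
  "muscl_scheme \<alpha> \<tau> h \<phi> fp fm U \<longleftrightarrow>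
     (\<forall>n j.
        let Fp = (\<lambda>i. fp (U n i)); sp = muscl_slope \<phi> h Fp;
            Fm = (\<lambda>i. fm (U n i)); sm = muscl_slope \<phi> h Fm
        in discrete_caputo \<alpha> \<tau> (\<lambda>m. U m j) n
             + 1 / h * ((Fp j + h / 2 * sp j) - (Fp (j - 1) + h / 2 * sp (j - 1)))
             + 1 / h * ((Fm (j + 1) - h / 2 * sm (j + 1)) - (Fm j - h / 2 * sm j)) = 0)"

definition total_variation :: "(int \<Rightarrow> real) \<Rightarrow> ennreal" where
  "total_variation v = (\<Sum>\<^sub>\<infinity>j\<in>UNIV. ennreal \<bar>v (j + 1) - v j\<bar>)"

definition sup_abs :: "'a set \<Rightarrow> ('a \<Rightarrow> real) \<Rightarrow> ennreal" where
  "sup_abs A g = (SUP x\<in>A. ennreal \<bar>g x\<bar>)"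

end

theory Submission
  imports Defs
begin

text \<open>
  Both limiters satisfy \<open>0 \<le> \<phi>(\<theta>) \<le> 2\<close> and \<open>\<phi>(\<theta>) = b \<theta>\<close> with \<open>0 \<le> b \<le> 2\<close>, so each slope is
  a multiple in \<open>[0,2]\<close> of both neighbouring difference quotients. With the mean value theorem this
  puts the scheme into Harten's incremental form
  \[ U_j^{n+1} = \sum_{k<n} c_k^{n+1} U_j^k + c_n^{n+1} U_j^n
       - A_j (U_j^n - U_{j-1}^n) + B_j (U_{j+1}^n - U_j^n), \]
  where \<open>A, B \<ge> 0\<close> and \<open>A_i + B_j \<le> 2 - 2 powr (1 - \<alpha>) \<le> c_n^{n+1}\<close>. Here one uses
  \<open>\<Gamma>(2 - \<alpha>) \<le> 1\<close>, because the CFL condition has \<open>\<Gamma>(2 - \<alpha>)\<close> in the denominator while the scheme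
  produces it in the numerator. As the \<open>c_k^{n+1}\<close> are nonnegative with sum 1, both claims follow
  by strong induction on the time level.
\<close>

subsection \<open>Coefficients of the discrete Caputo derivative\<close>

text \<open>By the mean value theorem the increments over the two adjacent unit intervals are values
  of \<open>b * z powr (b - 1)\<close>, which decreases in \<open>z\<close> as \<open>b < 1\<close>.
  Only continuity is used at the left endpoint, so \<open>x = 0\<close>, where the derivative blows
  up, is covered.\<close>

lemma powr_midpoint_concave:
  fixes x b :: real
  assumes "0 \<le> x" "0 < b" "b < 1"
  shows "x powr b + (x + 2) powr b \<le> 2 * (x + 1) powr b"
proof -
  have slope: "\<exists>z. a < z \<and> z < a + 1 \<and> (a + 1) powr b - a powr b = b * z powr (b - 1)"
    if "0 \<le> a" for a :: real
  proof -
    have "\<exists>l z. a < z \<and> z < a + 1 \<and> DERIV (\<lambda>z. z powr b) z :> l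
        \<and> (a + 1) powr b - a powr b = (a + 1 - a) * l"
    proof (rule MVT)
      show "continuous_on {a..a + 1} (\<lambda>z. z powr b)"
        using that assms by (intro continuous_on_powr' continuous_intros) auto
      show "(\<lambda>z. z powr b) differentiable (at z)" if "a < z" "z < a + 1" for z
        using has_real_derivative_powr[of z b] that \<open>0 \<le> a\<close> real_differentiable_def by force
    qed simp
    then obtain l z where z: "a < z" "z < a + 1" "DERIV (\<lambda>z. z powr b) z :> l"
        "(a + 1) powr b - a powr b = l"
      by auto
    moreover have "l = b * z powr (b - 1)"
      using DERIV_unique[OF z(3)] has_real_derivative_powr[of z b] z(1) that by simp
    ultimately show ?thesis by blast
  qed
  obtain y z where "x < y" "y < x + 1" "(x + 1) powr b - x powr b = b * y powr (b - 1)"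
      and "x + 1 < z" "(x + 2) powr b - (x + 1) powr b = b * z powr (b - 1)"
    using slope[of x] slope[of "x + 1"] assms by (auto simp: add.assoc)
  moreover from this have "b * z powr (b - 1) \<le> b * y powr (b - 1)"
    using assms by (intro mult_left_mono powr_mono2') auto
  ultimately show ?thesis
    by linarith
qed

text \<open>The first coefficient is an increment of the increasing function
  \<open>t powr (1 - \<alpha>)\<close>; every other one is a negated second difference of this
  concave function.\<close>

lemma caputo_coeff_nonneg:
  assumes "0 < \<alpha>" "\<alpha> < 1" "k \<le> n"
  shows "0 \<le> caputo_coeff \<alpha> n k"
proof (cases "k = 0")
  case True
  then show ?thesis
    using assms by (auto simp: caputo_coeff_def intro!: powr_mono2)
next
  case False
  have "real n - real k + 2 = real n + 2 - real k" "real n - real k + 1 = real n + 1 - real k"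
    by simp_all
  note * = powr_midpoint_concave[of "real n - real k" "1 - \<alpha>", unfolded this]
  have "(real n - real k) powr (1 - \<alpha>) + (real n + 2 - real k) powr (1 - \<alpha>)
      \<le> 2 * (real n + 1 - real k) powr (1 - \<alpha>)"
    using assms by (intro *) auto
  with False show ?thesis
    unfolding caputo_coeff_def by simp
qed

text \<open>Adding the next second difference replaces the current first difference by the following
  one. At \<open>m = n\<close> it is \<open>1 - 0\<close>.\<close>

lemma sum_caputo_coeff_telescope:
  "(\<Sum>k=0..m. caputo_coeff \<alpha> n k)
     = (real n + 1 - real m) powr (1 - \<alpha>) - (real n - real m) powr (1 - \<alpha>)"
proof (induction m)
  case 0
  show ?case by (simp add: caputo_coeff_def)
next
  case (Suc m)
  have eq: "real n + 1 - real (Suc m) = real n - real m"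
    "real n + 2 - real (Suc m) = real n + 1 - real m"
    by simp_all
  have "caputo_coeff \<alpha> n (Suc m) = 2 * (real n - real m) powr (1 - \<alpha>)
      - (real n + 1 - real m) powr (1 - \<alpha>) - (real n - real (Suc m)) powr (1 - \<alpha>)"
    unfolding caputo_coeff_def eq by simp
  with Suc show ?case
    unfolding eq sum.atLeast0_atMost_Suc by linarith
qed

lemma sum_caputo_coeff: "(\<Sum>k=0..n. caputo_coeff \<alpha> n k) = 1"
  by (simp add: sum_caputo_coeff_telescope)

text \<open>Equality holds for \<open>n > 0\<close>. For \<open>n = 0\<close> the coefficient is 1,
  from the separate formula for index 0, and the bound says
  \<open>1 \<le> 2 powr (1 - \<alpha>)\<close>.\<close>

lemma caputo_coeff_last_ge:
  assumes "\<alpha> < 1"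
  shows "2 - 2 powr (1 - \<alpha>) \<le> caputo_coeff \<alpha> n n"
  using ge_one_powr_ge_zero[of 2 "1 - \<alpha>"] assms by (simp add: caputo_coeff_def)

text \<open>The convex function \<open>ln (Gamma x)\<close> vanishes at 1 and 2, so it lies below
  the zero chord between them.\<close>

lemma Gamma_le_one:
  fixes x :: real
  assumes "1 \<le> x" "x \<le> 2"
  shows "Gamma x \<le> 1"
proof -
  have "Gamma (2::real) = 1"
    using Gamma_fact[of 1, where 'a = real] by simp
  then have "ln (Gamma x) \<le> 0"
    using convex_onD[OF log_convex_Gamma_real, of "x - 1" 1 2] assms by (simp add: algebra_simps)
  then show ?thesis
    using assms by simp
qed

subsection \<open>Limited slopes and the incremental form\<close>

text \<open>Stating the second bound with a factor \<open>b\<close> instead of the quotient by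
  \<open>\<theta>\<close> includes \<open>\<theta> = 0\<close>. The two conditions together force
  the limiter to vanish for \<open>\<theta> \<le> 0\<close>.\<close>

definition limiter_bounded :: "(real \<Rightarrow> real) \<Rightarrow> bool" where
  "limiter_bounded \<phi> \<longleftrightarrow> (\<forall>\<theta>. \<phi> \<theta> \<in> {0..2} \<and> (\<exists>b\<in>{0..2}. \<phi> \<theta> = b * \<theta>))"

lemma limiter_bounded_minmod: "limiter_bounded minmod"
  unfolding limiter_bounded_def
proof (intro allI conjI)
  fix \<theta> :: real
  show "minmod \<theta> \<in> {0..2}"
    by (auto simp: minmod_def)
  have "minmod \<theta> = (if \<theta> \<le> 0 then 0 else if \<theta> \<le> 1 then 1 else 1 / \<theta>) * \<theta>"
    by (auto simp: minmod_def)
  moreover have "(if \<theta> \<le> 0 then 0 else if \<theta> \<le> 1 then 1 else 1 / \<theta>) \<in> {0..2}"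
    by (auto simp: field_simps)
  ultimately show "\<exists>b\<in>{0..2}. minmod \<theta> = b * \<theta>"
    by blast
qed

lemma limiter_bounded_van_leer: "limiter_bounded van_leer"
  unfolding limiter_bounded_def
proof (intro allI conjI)
  fix \<theta> :: real
  show "van_leer \<theta> \<in> {0..2}"
    by (auto simp: van_leer_def field_simps)
  have "van_leer \<theta> = (if \<theta> \<le> 0 then 0 else 2 / (1 + \<theta>)) * \<theta>"
    by (auto simp: van_leer_def)
  moreover have "(if \<theta> \<le> 0 then 0 else 2 / (1 + \<theta>)) \<in> {0..2}"
    by (auto simp: field_simps)
  ultimately show "\<exists>b\<in>{0..2}. van_leer \<theta> = b * \<theta>"
    by blast
qed

text \<open>The factor for the backward difference is the limiter value itself. Writing that value
  as \<open>b * \<theta>\<close> cancels the denominator of \<open>\<theta>\<close> and leaves the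
  forward difference.\<close>

lemma muscl_slope_multiples:
  assumes "limiter_bounded \<phi>" "h > 0"
  obtains a b where "a \<in> {0..2}" "b \<in> {0..2}"
    "h * muscl_slope \<phi> h F j = a * (F j - F (j - 1))"
    "h * muscl_slope \<phi> h F j = b * (F (j + 1) - F j)"
proof (cases "F j = F (j - 1)")
  case True
  then show ?thesis
    by (intro that[of 0 0]) (auto simp: muscl_slope_def)
next
  case False
  define \<theta> where "\<theta> = (F (j + 1) - F j) / (F j - F (j - 1))"
  obtain b where b: "b \<in> {0..2}" "\<phi> \<theta> = b * \<theta>" "\<phi> \<theta> \<in> {0..2}"
    using assms(1) unfolding limiter_bounded_def by blast
  have slope: "h * muscl_slope \<phi> h F j = \<phi> \<theta> * (F j - F (j - 1))"
    using False assms(2) by (simp add: muscl_slope_def \<theta>_def)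
  also have "\<dots> = b * (F (j + 1) - F j)"
    unfolding b(2) using False by (simp add: \<theta>_def)
  finally show ?thesis
    using that b slope by blast
qed

text \<open>The slope at \<open>j\<close> is read as a multiple of its backward difference and the
  slope at \<open>j - 1\<close> as one of its forward difference. Both are the same jump, so it
  factors out; the upper bound 2 is the factor 2 in the CFL condition.\<close>

lemma muscl_left_flux_difference:
  assumes "limiter_bounded \<phi>" "h > 0"
  obtains r where "r \<in> {0..2}"
    "(F j + h / 2 * muscl_slope \<phi> h F j) - (F (j - 1) + h / 2 * muscl_slope \<phi> h F (j - 1))
       = r * (F j - F (j - 1))"
proof -
  obtain a where a: "a \<in> {0..2}" "h * muscl_slope \<phi> h F j = a * (F j - F (j - 1))"
    using muscl_slope_multiples[OF assms, of F j] by blast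
  obtain b where b: "b \<in> {0..2}" "h * muscl_slope \<phi> h F (j - 1) = b * (F j - F (j - 1))"
    using muscl_slope_multiples[OF assms, of F "j - 1"] by (metis diff_add_cancel)
  show ?thesis
  proof (rule that[of "1 + a / 2 - b / 2"])
    show "1 + a / 2 - b / 2 \<in> {0..2}"
      using a(1) b(1) by auto
  qed (use a(2) b(2) in \<open>simp add: algebra_simps\<close>)
qed

lemma muscl_right_flux_difference:
  assumes "limiter_bounded \<phi>" "h > 0"
  obtains r where "r \<in> {0..2}"
    "(F (j + 1) - h / 2 * muscl_slope \<phi> h F (j + 1)) - (F j - h / 2 * muscl_slope \<phi> h F j)
       = r * (F (j + 1) - F j)"
proof -
  obtain a where a: "a \<in> {0..2}" "h * muscl_slope \<phi> h F (j + 1) = a * (F (j + 1) - F j)"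
    using muscl_slope_multiples[OF assms, of F "j + 1"] by (metis add_diff_cancel_right')
  obtain b where b: "b \<in> {0..2}" "h * muscl_slope \<phi> h F j = b * (F (j + 1) - F j)"
    using muscl_slope_multiples[OF assms, of F j] by blast
  show ?thesis
  proof (rule that[of "1 - a / 2 + b / 2"])
    show "1 - a / 2 + b / 2 \<in> {0..2}"
      using a(1) b(1) by auto
  qed (use a(2) b(2) in \<open>simp add: algebra_simps\<close>)
qed

text \<open>This form of the mean value theorem allows any order of \<open>x\<close> and
  \<open>y\<close>, including equality, and keeps \<open>z\<close> in \<open>I\<close>, where the
  derivative bounds hold.\<close>

lemma increment_eq_deriv_mult:
  fixes g :: "real \<Rightarrow> real"
  assumes "\<And>x. DERIV g x :> g' x" "is_interval I" "x \<in> I" "y \<in> I"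
  obtains z where "z \<in> I" "g y - g x = g' z * (y - x)"
proof -
  have mvt: "\<exists>z\<in>I. g b - g a = g' z * (b - a)" if "a \<in> I" "b \<in> I" "a < b" for a b
  proof -
    obtain z where "a < z" "z < b" "g b - g a = (b - a) * g' z"
      using MVT2[of a b g g'] assms(1) \<open>a < b\<close> by blast
    then show ?thesis
      using mem_is_interval_1_I[OF assms(2) that(1,2), of z] by (auto simp: mult.commute)
  qed
  consider "x < y" | "x = y" | "y < x" by linarith
  then have "\<exists>z\<in>I. g y - g x = g' z * (y - x)"
  proof cases
    case 3
    then obtain z where "z \<in> I" "g x - g y = g' z * (x - y)"
      using mvt assms(3,4) by blast
    then show ?thesis
      by (intro bexI[of _ z]) (simp_all add: algebra_simps)
  qed (use mvt assms(3,4) in auto)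
  then show ?thesis
    using that by blast
qed

text \<open>The bound on \<open>A i + B j\<close> is uniform in both indices because the variation
  estimate needs it for \<open>i = j + 1\<close> and the maximum principle for
  \<open>i = j\<close>.\<close>

lemma muscl_scheme_incremental_form:
  assumes scheme: "muscl_scheme \<alpha> \<tau> h \<phi> fp fm U"
    and lim: "limiter_bounded \<phi>" and pos: "\<alpha> < 1" "0 < \<tau>" "0 < h"
    and deriv: "\<And>x. DERIV fp x :> fp' x" "\<And>x. DERIV fm x :> fm' x"
    and int: "is_interval I" "\<And>j. U n j \<in> I"
    and bounds: "\<And>x. x \<in> I \<Longrightarrow> fp' x \<in> {0..Lp}" "\<And>x. x \<in> I \<Longrightarrow> - fm' x \<in> {0..Lm}"
    and cfl: "2 * (Gamma (2 - \<alpha>) * \<tau> powr \<alpha> / h) * (Lp + Lm) \<le> C"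
  obtains A B where "\<And>j. 0 \<le> A j" "\<And>j. 0 \<le> B j" "\<And>i j. A i + B j \<le> C"
    "\<And>j. U (Suc n) j = (\<Sum>k<n. caputo_coeff \<alpha> n k * U k j) + caputo_coeff \<alpha> n n * U n j
            - A j * (U n j - U n (j - 1)) + B j * (U n (j + 1) - U n j)"
proof -
  define G where "G = Gamma (2 - \<alpha>) * \<tau> powr \<alpha>"
  define l where "l = G / h"
  have "G > 0"
    using pos by (simp add: G_def)
  then have "l > 0"
    using pos by (simp add: l_def)
  define Fp Fm where "Fp = (\<lambda>i. fp (U n i))" and "Fm = (\<lambda>i. fm (U n i))"
  let ?sp = "muscl_slope \<phi> h Fp" and ?sm = "muscl_slope \<phi> h Fm"
  have "\<exists>a. 0 \<le> a \<and> a \<le> 2 * l * Lp \<and>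
      l * ((Fp j + h / 2 * ?sp j) - (Fp (j - 1) + h / 2 * ?sp (j - 1)))
        = a * (U n j - U n (j - 1))" for j
  proof -
    obtain r where r: "r \<in> {0..2}"
      "(Fp j + h / 2 * ?sp j) - (Fp (j - 1) + h / 2 * ?sp (j - 1)) = r * (Fp j - Fp (j - 1))"
      using muscl_left_flux_difference[OF lim pos(3)] by blast
    obtain z where z: "z \<in> I" "Fp j - Fp (j - 1) = fp' z * (U n j - U n (j - 1))"
      using increment_eq_deriv_mult[OF deriv(1) int(1) int(2) int(2)] unfolding Fp_def by blast
    have "r * fp' z \<le> 2 * Lp"
      using r(1) bounds(1)[OF z(1)] by (intro mult_mono) auto
    then have "l * (r * fp' z) \<le> l * (2 * Lp)"
      using \<open>l > 0\<close> by simp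
    moreover have "0 \<le> l * (r * fp' z)"
      using \<open>l > 0\<close> r(1) bounds(1)[OF z(1)] by simp
    ultimately show ?thesis
      unfolding r(2) z(2) by (intro exI[of _ "l * (r * fp' z)"]) (simp add: ac_simps)
  qed
  then obtain A where A: "\<And>j. 0 \<le> A j" "\<And>j. A j \<le> 2 * l * Lp"
    "\<And>j. l * ((Fp j + h / 2 * ?sp j) - (Fp (j - 1) + h / 2 * ?sp (j - 1)))
        = A j * (U n j - U n (j - 1))"
    by metis
  have "\<exists>b. 0 \<le> b \<and> b \<le> 2 * l * Lm \<and>
      l * ((Fm (j + 1) - h / 2 * ?sm (j + 1)) - (Fm j - h / 2 * ?sm j))
        = - b * (U n (j + 1) - U n j)" for j
  proof -
    obtain r where r: "r \<in> {0..2}"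
      "(Fm (j + 1) - h / 2 * ?sm (j + 1)) - (Fm j - h / 2 * ?sm j) = r * (Fm (j + 1) - Fm j)"
      using muscl_right_flux_difference[OF lim pos(3)] by blast
    obtain z where z: "z \<in> I" "Fm (j + 1) - Fm j = fm' z * (U n (j + 1) - U n j)"
      using increment_eq_deriv_mult[OF deriv(2) int(1) int(2) int(2)] unfolding Fm_def by blast
    \<comment> \<open>Since \<open>fm\<close> is nonincreasing, the sign is moved so that the
      coefficient of the forward difference becomes nonnegative.\<close>
    have "r * - fm' z \<le> 2 * Lm"
      using r(1) bounds(2)[OF z(1)] by (intro mult_mono) auto
    then have "l * (r * - fm' z) \<le> l * (2 * Lm)"
      using \<open>l > 0\<close> by (intro mult_left_mono) auto
    moreover have "0 \<le> l * (r * - fm' z)"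
      using \<open>l > 0\<close> r(1) bounds(2)[OF z(1)] by (intro mult_nonneg_nonneg) auto
    ultimately show ?thesis
      unfolding r(2) z(2) by (intro exI[of _ "l * (r * - fm' z)"]) (simp add: ac_simps)
  qed
  then obtain B where B: "\<And>j. 0 \<le> B j" "\<And>j. B j \<le> 2 * l * Lm"
    "\<And>j. l * ((Fm (j + 1) - h / 2 * ?sm (j + 1)) - (Fm j - h / 2 * ?sm j))
        = - B j * (U n (j + 1) - U n j)"
    by metis
  show ?thesis
  proof (rule that[OF A(1) B(1)])
    show "A i + B j \<le> C" for i j
      using A(2)[of i] B(2)[of j] cfl by (simp add: l_def G_def distrib_left)
    fix j
    define P where "P = (Fp j + h / 2 * ?sp j) - (Fp (j - 1) + h / 2 * ?sp (j - 1))"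
    define M where "M = (Fm (j + 1) - h / 2 * ?sm (j + 1)) - (Fm j - h / 2 * ?sm j)"
    define S where "S = (\<Sum>k=0..n. caputo_coeff \<alpha> n k * U k j)"
    have "1 / G * (U (Suc n) j - S) + 1 / h * P + 1 / h * M = 0"
      using scheme unfolding muscl_scheme_def discrete_caputo_def Let_def
        P_def M_def S_def Fp_def Fm_def G_def by blast
    \<comment> \<open>Multiplying by \<open>G\<close> solves for the new level and turns
      \<open>1 / h\<close> into \<open>l = G / h\<close>; this puts the Gamma factor into the
      numerator.\<close>
    then have "G * (1 / G * (U (Suc n) j - S) + 1 / h * P + 1 / h * M) = 0"
      by simp
    then have "U (Suc n) j = S - l * P - l * M"
      using \<open>G > 0\<close> by (simp add: l_def distrib_left)
    moreover have "S = (\<Sum>k<n. caputo_coeff \<alpha> n k * U k j) + caputo_coeff \<alpha> n n * U n j"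
      by (simp add: S_def atLeast0AtMost flip: lessThan_Suc_atMost)
    ultimately show "U (Suc n) j
        = (\<Sum>k<n. caputo_coeff \<alpha> n k * U k j) + caputo_coeff \<alpha> n n * U n j
            - A j * (U n j - U n (j - 1)) + B j * (U n (j + 1) - U n j)"
      using A(3)[of j] B(3)[of j] unfolding P_def M_def by linarith
  qed
qed

subsection \<open>Invariance and variation estimates for one step\<close>

text \<open>The terms containing \<open>c n\<close>, \<open>a\<close> and \<open>b\<close> equal
  \<open>c n * q\<close>, where \<open>q\<close> is a convex combination of \<open>w n\<close>,
  \<open>x\<close> and \<open>y\<close>. The result is then a convex combination of the history
  values and \<open>q\<close>.\<close>

lemma incremental_step_mem_convex:
  fixes w :: "nat \<Rightarrow> real"
  assumes J: "convex J" "\<And>k. k \<le> n \<Longrightarrow> w k \<in> J" "x \<in> J" "y \<in> J"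
    and c: "\<And>k. k \<le> n \<Longrightarrow> 0 \<le> c k" "(\<Sum>k=0..n. c k) = 1" "0 < c n"
    and ab: "0 \<le> a" "0 \<le> b" "a + b \<le> c n"
  shows "(\<Sum>k<n. c k * w k) + c n * w n - a * (w n - x) + b * (y - w n) \<in> J"
proof -
  define q where "q = (1 - a / c n - b / c n) * w n + (a / c n) * x + (b / c n) * y"
  have "a / c n + b / c n \<le> 1"
    using ab c(3) by (simp add: add_divide_distrib[symmetric])
  \<comment> \<open>List indexing presents the three-point combination as the indexed sum that
    \<open>convex_sum\<close> expects.\<close>
  then have "(\<Sum>i\<in>{0,1,2::nat}. ([1 - a / c n - b / c n, a / c n, b / c n] ! i) *\<^sub>R ([w n, x, y] ! i)) \<in> J"
    using J ab c(3) by (intro convex_sum) auto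
  then have "q \<in> J"
    by (simp add: q_def add.assoc)
  then have "(\<Sum>k\<in>{0..n}. c k *\<^sub>R (if k = n then q else w k)) \<in> J"
    using J c by (intro convex_sum) auto
  moreover have "(\<Sum>k\<in>{0..n}. c k *\<^sub>R (if k = n then q else w k)) = (\<Sum>k<n. c k * w k) + c n * q"
    by (simp add: atLeast0AtMost flip: lessThan_Suc_atMost)
  moreover have "c n * q = c n * w n - a * (w n - x) + b * (y - w n)"
    using c(3) by (simp add: q_def algebra_simps)
  ultimately show ?thesis
    unfolding add_diff_eq[symmetric] add.assoc by simp
qed

section \<open>Sums over the integers in [0, infinity] and total variation\<close>

lemma infsum_add_ennreal:
  fixes f g :: "'a \<Rightarrow> ennreal"
  shows "(\<Sum>\<^sub>\<infinity>x\<in>S. f x + g x) = (\<Sum>\<^sub>\<infinity>x\<in>S. f x) + (\<Sum>\<^sub>\<infinity>x\<in>S. g x)"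
  by (intro infsum_add nonneg_summable_on_complete) auto

lemma infsum_cmult_right_ennreal:
  fixes f :: "'a \<Rightarrow> ennreal"
  shows "(\<Sum>\<^sub>\<infinity>x\<in>S. c * f x) = c * (\<Sum>\<^sub>\<infinity>x\<in>S. f x)"
  by (simp add: nonneg_infsum_complete SUP_mult_left_ennreal sum_distrib_left)

lemma infsum_int_shift:
  fixes f :: "int \<Rightarrow> 'a::{comm_monoid_add, t2_space}"
  shows "(\<Sum>\<^sub>\<infinity>j\<in>UNIV. f (j + a)) = (\<Sum>\<^sub>\<infinity>j\<in>UNIV. f j)"
  by (intro infsum_reindex_bij_betw bij_betw_byWitness[where f' = "\<lambda>j. j - a"]) auto

lemma total_variation_add_le:
  "total_variation (\<lambda>j. u j + v j) \<le> total_variation u + total_variation v"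
proof -
  have "total_variation (\<lambda>j. u j + v j)
      \<le> (\<Sum>\<^sub>\<infinity>j\<in>UNIV. ennreal \<bar>u (j + 1) - u j\<bar> + ennreal \<bar>v (j + 1) - v j\<bar>)"
    unfolding total_variation_def
    by (intro infsum_mono nonneg_summable_on_complete)
      (auto simp flip: ennreal_plus intro!: ennreal_leI)
  then show ?thesis
    by (simp add: infsum_add_ennreal total_variation_def)
qed

lemma total_variation_cmult:
  assumes "0 \<le> c"
  shows "total_variation (\<lambda>j. c * u j) = ennreal c * total_variation u"
proof -
  have "\<bar>c * u (j + 1) - c * u j\<bar> = c * \<bar>u (j + 1) - u j\<bar>" for j
    using assms by (simp add: abs_mult flip: right_diff_distrib)
  then show ?thesis
    using assms by (simp add: total_variation_def ennreal_mult infsum_cmult_right_ennreal)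
qed

lemma total_variation_sum_le:
  assumes "finite K" "\<And>k. k \<in> K \<Longrightarrow> 0 \<le> c k"
  shows "total_variation (\<lambda>j. \<Sum>k\<in>K. c k * u k j) \<le> (\<Sum>k\<in>K. ennreal (c k) * total_variation (u k))"
  using assms
proof (induction K rule: finite_induct)
  case empty
  then show ?case by (simp add: total_variation_def)
next
  case (insert k K)
  then have "total_variation (\<lambda>j. c k * u k j + (\<Sum>k\<in>K. c k * u k j))
      \<le> ennreal (c k) * total_variation (u k) + (\<Sum>k\<in>K. ennreal (c k) * total_variation (u k))"
    by (intro order.trans[OF total_variation_add_le] add_mono)
      (auto simp: total_variation_cmult)
  with insert show ?case by simp
qed

text \<open>Harten's argument: a jump of the new values combines three neighbouring old jumps with
  nonnegative coefficients. After shifting indices, each old jump has total weight \<open>c\<close>.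
  Working in \<open>ennreal\<close> keeps this valid for infinite variation.\<close>

lemma total_variation_incremental_le:
  assumes "\<And>j. 0 \<le> A j" "\<And>j. 0 \<le> B j" "\<And>j. A (j + 1) + B j \<le> c"
  shows "total_variation (\<lambda>j. c * u j - A j * (u j - u (j - 1)) + B j * (u (j + 1) - u j))
           \<le> ennreal c * total_variation u" (is "total_variation ?v \<le> _")
proof -
  define d where "d j = u (j + 1) - u j" for j
  define a b where "a j = ennreal (A (j + 1) * \<bar>d j\<bar>)" and "b j = ennreal (B j * \<bar>d j\<bar>)" for j
  define e where "e j = ennreal ((c - A (j + 1) - B j) * \<bar>d j\<bar>)" for j
  have "ennreal \<bar>?v (j + 1) - ?v j\<bar> \<le> e j + a (j - 1) + b (j + 1)" for j
  proof -
    have "?v (j + 1) - ?v j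
        = (c - A (j + 1) - B j) * d j + A j * d (j - 1) + B (j + 1) * d (j + 1)"
      by (simp add: d_def algebra_simps)
    then have "\<bar>?v (j + 1) - ?v j\<bar>
        \<le> \<bar>(c - A (j + 1) - B j) * d j\<bar> + \<bar>A j * d (j - 1)\<bar> + \<bar>B (j + 1) * d (j + 1)\<bar>"
      by linarith
    also have "\<dots> = (c - A (j + 1) - B j) * \<bar>d j\<bar> + A j * \<bar>d (j - 1)\<bar> + B (j + 1) * \<bar>d (j + 1)\<bar>"
      using assms(1)[of j] assms(2)[of "j + 1"] assms(3)[of j] by (simp add: abs_mult)
    finally show ?thesis
      using assms(1)[of j] assms(2)[of "j + 1"] assms(3)[of j]
      by (simp add: a_def b_def e_def ennreal_leI flip: ennreal_plus)
  qed
  then have "total_variation ?v \<le> (\<Sum>\<^sub>\<infinity>j\<in>UNIV. e j + a (j - 1) + b (j + 1))"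
    unfolding total_variation_def by (intro infsum_mono nonneg_summable_on_complete) auto
  \<comment> \<open>Translation of the index moves the contributions of the neighbouring jumps back
    to \<open>j\<close>.\<close>
  also have "\<dots> = (\<Sum>\<^sub>\<infinity>j\<in>UNIV. e j) + (\<Sum>\<^sub>\<infinity>j\<in>UNIV. a j) + (\<Sum>\<^sub>\<infinity>j\<in>UNIV. b j)"
    using infsum_int_shift[of a "-1"] by (simp add: infsum_add_ennreal infsum_int_shift)
  also have "\<dots> = (\<Sum>\<^sub>\<infinity>j\<in>UNIV. e j + a j + b j)"
    by (simp add: infsum_add_ennreal)
  also have "e j + a j + b j = ennreal c * ennreal \<bar>d j\<bar>" for j
  proof -
    have "0 \<le> c"
      using assms(1)[of "j + 1"] assms(2)[of j] assms(3)[of j] by linarith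
    have "e j + a j + b j
        = ennreal ((c - A (j + 1) - B j) * \<bar>d j\<bar> + A (j + 1) * \<bar>d j\<bar> + B j * \<bar>d j\<bar>)"
      using assms(1)[of "j + 1"] assms(2)[of j] assms(3)[of j]
      by (simp add: a_def b_def e_def flip: ennreal_plus)
    also have "\<dots> = ennreal (c * \<bar>d j\<bar>)"
      by (simp add: algebra_simps)
    finally show ?thesis
      using \<open>0 \<le> c\<close> by (simp add: ennreal_mult)
  qed
  then have "(\<Sum>\<^sub>\<infinity>j\<in>UNIV. e j + a j + b j) = ennreal c * total_variation u"
    by (simp add: infsum_cmult_right_ennreal total_variation_def d_def)
  finally show ?thesis .
qed

section \<open>Maximum principle and TVD estimate at all time levels\<close>

lemma abs_le_of_ennreal_le_sup_abs:
  assumes "x \<in> S" "sup_abs S g \<le> ennreal L" "0 \<le> L"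
  shows "\<bar>g x\<bar> \<le> L"
proof -
  have "ennreal \<bar>g x\<bar> \<le> sup_abs S g"
    unfolding sup_abs_def using assms(1) by (intro SUP_upper)
  then show ?thesis
    using assms(2,3) by (auto dest: order.trans)
qed

theorem mainTheorem4:
  fixes \<alpha> \<tau> h :: real
    and f fp fm \<phi> :: "real \<Rightarrow> real"
    and U :: "nat \<Rightarrow> int \<Rightarrow> real"
    and I :: "real set"
  assumes "0 < \<alpha>" and "\<alpha> < 1" and "\<tau> > 0" and "h > 0"
    and "\<And>x. f x = fp x + fm x"
    and "fp C1_differentiable_on UNIV" and "fm C1_differentiable_on UNIV"
    and "\<And>x. deriv fp x \<ge> 0" and "\<And>x. deriv fm x \<le> 0"
    and "\<phi> = minmod \<or> \<phi> = van_leer"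
    and "muscl_scheme \<alpha> \<tau> h \<phi> fp fm U"
    and "is_interval I" and "\<And>j. U 0 j \<in> I"
    and CFL: "ennreal (2 * \<tau> powr \<alpha> / (h * Gamma (2 - \<alpha>)))
                * (sup_abs I (deriv fp) + sup_abs I (deriv fm))
              \<le> ennreal (2 - 2 powr (1 - \<alpha>))"
  shows "\<forall>n\<ge>1. total_variation (U n) \<le> total_variation (U 0)
               \<and> sup_abs UNIV (U n) \<le> sup_abs UNIV (U 0)"
proof -
  define C where "C = 2 - 2 powr (1 - \<alpha>)"
  define K where "K = 2 * \<tau> powr \<alpha> / (h * Gamma (2 - \<alpha>))"
  have "C > 0"
    using powr_less_mono[of "1 - \<alpha>" 1 2] assms(1) by (simp add: C_def)
  have "K > 0"
    using assms(2-4) by (simp add: K_def)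
  \<comment> \<open>A finite product with a positive factor makes both suprema finite, so real
    bounds \<open>Lp\<close> and \<open>Lm\<close> exist.\<close>
  have "ennreal K * (sup_abs I (deriv fp) + sup_abs I (deriv fm)) < top"
    using CFL unfolding K_def by (rule le_less_trans) simp
  then have "sup_abs I (deriv fp) < top" "sup_abs I (deriv fm) < top"
    using \<open>K > 0\<close> by (auto simp: ennreal_mult_less_top)
  then obtain Lp Lm where L: "0 \<le> Lp" "sup_abs I (deriv fp) = ennreal Lp"
      "0 \<le> Lm" "sup_abs I (deriv fm) = ennreal Lm"
    by (metis enn2real_nonneg ennreal_enn2real)
  have "K * (Lp + Lm) \<le> C"
    using CFL L \<open>K > 0\<close> \<open>C > 0\<close>
    by (simp add: K_def[symmetric] C_def[symmetric] flip: ennreal_plus ennreal_mult)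
  moreover have "2 * (Gamma (2 - \<alpha>) * \<tau> powr \<alpha> / h) \<le> K"
  proof -
    have "0 < Gamma (2 - \<alpha>)" "Gamma (2 - \<alpha>) \<le> 1"
      using assms(1,2) Gamma_le_one[of "2 - \<alpha>"] by auto
    then have "Gamma (2 - \<alpha>) \<le> 1 / Gamma (2 - \<alpha>)"
      by (simp add: field_simps mult_le_one)
    then have "2 * \<tau> powr \<alpha> / h * Gamma (2 - \<alpha>) \<le> 2 * \<tau> powr \<alpha> / h * (1 / Gamma (2 - \<alpha>))"
      using assms(4) by (intro mult_left_mono) auto
    then show ?thesis
      by (simp add: K_def ac_simps)
  qed
  ultimately have cfl: "2 * (Gamma (2 - \<alpha>) * \<tau> powr \<alpha> / h) * (Lp + Lm) \<le> C"
    using L mult_right_mono[of "2 * (Gamma (2 - \<alpha>) * \<tau> powr \<alpha> / h)" K "Lp + Lm"] by linarith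
  have lim: "limiter_bounded \<phi>"
    using assms(10) limiter_bounded_minmod limiter_bounded_van_leer by blast
  have deriv: "DERIV fp x :> deriv fp x" "DERIV fm x :> deriv fm x" for x
    using assms(6,7)
    by (auto simp: C1_differentiable_on_eq DERIV_deriv_iff_real_differentiable)
  have bounds: "deriv fp x \<in> {0..Lp}" "- deriv fm x \<in> {0..Lm}" if "x \<in> I" for x
    using abs_le_of_ennreal_le_sup_abs[OF that, of "deriv fp" Lp]
      abs_le_of_ennreal_le_sup_abs[OF that, of "deriv fm" Lm] L assms(8,9)[of x] by auto
  \<comment> \<open>The premise left open is that the level lies in \<open>I\<close>; it has to be
    proved along with the evolution.\<close>
  note step = muscl_scheme_incremental_form[OF assms(11) lim assms(2-4) deriv assms(12) _ bounds cfl]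
  have c_nonneg: "0 \<le> caputo_coeff \<alpha> n k" if "k \<le> n" for n k
    using caputo_coeff_nonneg assms(1,2) that by blast
  have c_last: "C \<le> caputo_coeff \<alpha> n n" for n
    using caputo_coeff_last_ge assms(2) by (simp add: C_def)

  \<comment> \<open>This is used twice: \<open>J = I\<close> makes the incremental form available at
    every level, and \<open>J = I \<inter> {-M..M}\<close> gives the maximum principle. The
    inclusion in \<open>I\<close> is what lets \<open>step\<close> apply inside the
    induction.\<close>
  have invariant: "U n j \<in> J" if J: "convex J" "J \<subseteq> I" "\<And>j. U 0 j \<in> J" for J n j
  proof (induction n arbitrary: j rule: less_induct)
    case (less n)
    show ?case
    proof (cases n)
      case 0
      then show ?thesis using J by simp
    next
      case (Suc m)
      have mem: "U k j \<in> J" if "k \<le> m" for k j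
        using less Suc that by simp
      obtain A B where AB: "\<And>j. 0 \<le> A j" "\<And>j. 0 \<le> B j" "\<And>i j. A i + B j \<le> C"
        "\<And>j. U (Suc m) j = (\<Sum>k<m. caputo_coeff \<alpha> m k * U k j) + caputo_coeff \<alpha> m m * U m j
            - A j * (U m j - U m (j - 1)) + B j * (U m (j + 1) - U m j)"
        using step[of m] mem J(2) by blast
      show ?thesis
        unfolding Suc AB(4)
        by (rule incremental_step_mem_convex[where w = "\<lambda>k. U k j" and c = "caputo_coeff \<alpha> m"])
          (use J(1) mem c_nonneg sum_caputo_coeff \<open>C > 0\<close> c_last[of m] AB(1,2) AB(3)[of j j]
           in \<open>auto intro: order.trans less_le_trans\<close>)
    qed
  qed

  have tvd: "total_variation (U n) \<le> total_variation (U 0)" for n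
  proof (induction n rule: less_induct)
    case (less n)
    show ?case
    proof (cases n)
      case (Suc m)
      have "U m j \<in> I" for j
        using invariant[of I] assms(12,13) by (simp add: is_interval_convex_1)
      then obtain A B where AB: "\<And>j. 0 \<le> A j" "\<And>j. 0 \<le> B j" "\<And>i j. A i + B j \<le> C"
        "\<And>j. U (Suc m) j = (\<Sum>k<m. caputo_coeff \<alpha> m k * U k j) + caputo_coeff \<alpha> m m * U m j
            - A j * (U m j - U m (j - 1)) + B j * (U m (j + 1) - U m j)"
        using step[of m] by blast
      let ?c = "caputo_coeff \<alpha> m"
      \<comment> \<open>The history sum is split from the Harten step at level \<open>m\<close>, so
        that subadditivity bounds the former and \<open>total_variation_incremental_le\<close> the
        latter.\<close>
      have "U (Suc m) = (\<lambda>j. (\<Sum>k<m. ?c k * U k j) + (?c m * U m j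
            - A j * (U m j - U m (j - 1)) + B j * (U m (j + 1) - U m j)))"
        by (simp add: AB(4) fun_eq_iff)
      then have "total_variation (U (Suc m))
          \<le> (\<Sum>k<m. ennreal (?c k) * total_variation (U k)) + ennreal (?c m) * total_variation (U m)"
        using c_nonneg AB(1,2) order.trans[OF AB(3) c_last[of m]]
        by (simp only:) (intro order.trans[OF total_variation_add_le] add_mono
            total_variation_sum_le total_variation_incremental_le; simp)
      also have "\<dots> = (\<Sum>k=0..m. ennreal (?c k) * total_variation (U k))"
        by (simp add: atLeast0AtMost flip: lessThan_Suc_atMost)
      \<comment> \<open>The memory term involves all earlier levels, hence the strong induction; the
        weights then sum to 1.\<close>
      also have "\<dots> \<le> (\<Sum>k=0..m. ennreal (?c k) * total_variation (U 0))"
        using less Suc by (intro sum_mono mult_left_mono) auto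
      also have "\<dots> = ennreal (\<Sum>k=0..m. ?c k) * total_variation (U 0)"
        using c_nonneg by (subst sum_ennreal[symmetric]) (auto simp: sum_distrib_right)
      finally show ?thesis
        by (simp add: Suc sum_caputo_coeff)
    qed simp
  qed

  have maximum: "sup_abs UNIV (U n) \<le> sup_abs UNIV (U 0)" for n
  \<comment> \<open>Unbounded initial data make the claim trivial; otherwise the supremum is a real
    \<open>M\<close>.\<close>
  proof (cases "sup_abs UNIV (U 0) = top")
    case False
    then obtain M where M: "0 \<le> M" "sup_abs UNIV (U 0) = ennreal M"
      by (metis enn2real_nonneg ennreal_enn2real top.not_eq_extremum)
    have "U n j \<in> I \<inter> {-M..M}" for j
    proof (rule invariant)
      show "U 0 j \<in> I \<inter> {-M..M}" for j
        using abs_le_of_ennreal_le_sup_abs[of j UNIV "U 0" M] M assms(13) by (auto simp: abs_le_iff)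
    qed (use assms(12) in \<open>auto simp: is_interval_convex_1 intro: convex_Int\<close>)
    then show ?thesis
      unfolding M(2) unfolding sup_abs_def
      by (intro SUP_least ennreal_leI) (simp add: abs_le_iff minus_le_iff)
  qed simp
  from tvd maximum show ?thesis by blast
qed

end
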